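(* Consider the B-PAC procedure defined in the context: $(X_t)_{t\ge 1}$ are i.i.d., the exploration probabilities are two-stage, $\rho_t=\rho_{\text{warm}}\mathbb{I}\{t\le T_{\text{warm}}\}+\rho_{\text{deploy}}\mathbb{I}\{t>T_{\text{warm}}\}$ with $0<\rho_{\text{deploy}}\le\rho_{\text{warm}}<1$ (so $\rho_{\min}=\rho_{\text{deploy}}$), the wealth processes are $(K_t(u))_{t\ge0}$, $u\in\mathcal{U}$, and the thresholds are $$\hat u_t=\max\Big\{u^{(i)}\in\mathcal{U}:\ \forall j\le i,\ K_t(u^{(j)})\ge \tfrac1\alpha\Big\}$$ (with $\hat u_t=0$ if this set is empty). Then for any $\alpha\in(0,1)$, any $\epsilon\in(0,1)$, and any choice of nonnegative $\mathcal{F}_{t-1}$-measurable bets $\lambda_t(u)$ ($t\ge1$, $u\in\mathcal{U}$) satisfying $1+\lambda_t(u)D_t(u)\ge0$, $$\mathbb{P}\big(\forall t\in\mathbb{N}:\ R_t(\hat u_t)\le\epsilon\big)\ge 1-\alpha,$$ where $\mathbb N=\{1,2,\dots\}$ and $R_t(\hat u_t)$ denotes the deterministic function $u\mapsto R_t(u)$ evaluated at the random point $\hat u_t$.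
   Context: Setting. $\mathcal{X},\mathcal{Y}$ are measurable spaces; $f,\tilde f:\mathcal{X}\to\mathcal{Y}$ are fixed measurable maps ("thinking" and "non-thinking" model); $l:\mathcal{Y}\times\mathcal{Y}\to[0,1]$ is a measurable loss. Queries $X_1,X_2,\dots$ are i.i.d. random elements of $\mathcal{X}$. Write $l_t=l(\tilde f(X_t),f(X_t))\in[0,1]$, and let $U_t\in[0,1]$ be the uncertainty score of $\tilde f(X_t)$, a fixed measurable function of $X_t$ (the same function for all $t$). Fix a finite grid $\mathcal{U}=\{u^{(1)},\dots,u^{(N)}\}$ with $0=u^{(1)}<u^{(2)}<\dots<u^{(N)}=1$. Exploration probabilities $\rho_t\in(0,1)$ are deterministic, and $\rho_{\min}=\inf_{t\ge1}\rho_t$. Procedure. Start with $\hat u_0=0$ and $K_0(u)=1$ for all $u\in\mathcal{U}$. At each time $t\ge1$: (1) $\pi_t=\mathbb{I}\{U_t\ge\hat u_{t-1}\}+\rho_t\mathbb{I}\{U_t<\hat u_{t-1}\}$. (2) Using internal randomization, independent of the data, draw $\xi_t$ which is Bernoulli$(\pi_t)$ conditionally on $\mathcal{F}_{t-1}$ and $X_t$, where $\mathcal{F}_t=\sigma(\{(X_i,\tilde f(X_i),l_i\xi_i,U_i)\}_{i=1}^t)$ ($\mathcal{F}_0$ trivial). In particular $X_t$ is independent of $\mathcal{F}_{t-1}$. (3) For $u\in\mathcal{U}$, $Z_t(u)=(1-\rho_{\min})\frac{l_t}{\pi_t}\xi_t\mathbb{I}\{U_t<u\}$ and $D_t(u)=\epsilon-Z_t(u)$.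 (4) $K_t(u)=K_{t-1}(u)\,(1+\lambda_t(u)D_t(u))$, where $\lambda_t(u)\ge0$ is $\mathcal{F}_{t-1}$-measurable with $1+\lambda_t(u)D_t(u)\ge0$. (5) $\hat u_t$ is computed from $(K_t(u))_{u\in\mathcal{U}}$ by the rule in the claim. Risk. For fixed $u\in\mathcal{U}$, $R_t(u)=\mathbb{E}[l_t\mathbb{I}\{\xi_t(u)=0\}]$, where $\xi_t(u)$ is, conditionally on $X_t$, Bernoulli with parameter $\mathbb{I}\{U_t\ge u\}+\rho_t\mathbb{I}\{U_t<u\}$. *)

theory Defs
  imports "HOL-Probability.Probability"
begin

definition two_stage_rate :: "real \<Rightarrow> real \<Rightarrow> nat \<Rightarrow> nat \<Rightarrow> real" where
  "two_stage_rate r_warm r_deploy T_warm t =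
     r_warm * of_bool (t \<le> T_warm) + r_deploy * of_bool (t > T_warm)"

definition min_rate :: "(nat \<Rightarrow> real) \<Rightarrow> real" where
  "min_rate r = (INF t\<in>{1..}. r t)"

text \<open>Probability of calling the thinking model at exploration rate r, threshold v and uncertainty
  score s.\<close>

definition query_prob :: "real \<Rightarrow> real \<Rightarrow> real \<Rightarrow> real" where
  "query_prob r v s = of_bool (s \<ge> v) + r * of_bool (s < v)"

text \<open>The sigma-algebra on the sample space of M generated by the S-valued variables V 1, ..., V t
  (trivial for t = 0). Only the sets of this measure space matter.\<close>

definition history :: "'w measure \<Rightarrow> 'o measure \<Rightarrow> (nat \<Rightarrow> 'w \<Rightarrow> 'o) \<Rightarrow> nat \<Rightarrow> 'w measure" where
  "history M S V t =
     sigma (space M) (\<Union>i\<in>{1..t}. {V i -` A \<inter> space M | A. A \<in> sets S})"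

definition adjoin :: "'w measure \<Rightarrow> 'x measure \<Rightarrow> ('w \<Rightarrow> 'x) \<Rightarrow> 'w measure" where
  "adjoin F S Y = sigma (space F) (sets F \<union> {Y -` A \<inter> space F | A. A \<in> sets S})"

definition cond_bernoulli ::
    "'w measure \<Rightarrow> 'w measure \<Rightarrow> ('w \<Rightarrow> real) \<Rightarrow> ('w \<Rightarrow> real) \<Rightarrow> bool" where
  "cond_bernoulli M G \<xi> p \<longleftrightarrow>
     \<xi> \<in> borel_measurable M \<and> (\<forall>\<omega>\<in>space M. \<xi> \<omega> \<in> {0, 1}) \<and>
     (AE \<omega> in M. real_cond_exp M G (indicator {\<omega>'\<in>space M. \<xi> \<omega>' = 1}) \<omega> = p \<omega>)"

definition threshold :: "(nat \<Rightarrow> real) \<Rightarrow> nat \<Rightarrow> real \<Rightarrow> (real \<Rightarrow> real) \<Rightarrow> real" where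
  "threshold u N \<alpha> k =
     (let S = {u i | i. i \<in> {1..N} \<and> (\<forall>j\<in>{1..i}. k (u j) \<ge> 1 / \<alpha>)}
      in if S = {} then 0 else Max S)"

text \<open>The expectation of the loss L on the event that the coin b comes up False, where, conditionally
  on the query, b is Bernoulli with the query probability of the fixed threshold v. The coin is not
  a variable on M: it is integrated out against its conditional law.\<close>

definition risk :: "'w measure \<Rightarrow> ('w \<Rightarrow> real) \<Rightarrow> ('w \<Rightarrow> real) \<Rightarrow> real \<Rightarrow> real \<Rightarrow> real" where
  "risk M L U r v =
     (\<integral>\<omega>. measure_pmf.expectation (bernoulli_pmf (query_prob r v (U \<omega>)))
            (\<lambda>b. L \<omega> * of_bool (b = False)) \<partial>M)"

end

theory Submission
  imports Defs
begin

text \<open>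
  Write \<open>R v = (1 - \<rho>_min) E[l 1{score < v}]\<close> for the risk at the smallest exploration rate; it bounds the
  risk at every time. If some grid point has \<open>R > \<epsilon>\<close>, let \<open>v\<close> be the first one. Inverse-probability
  weighting makes the conditional mean of \<open>Z t v\<close> given the past equal to \<open>R v > \<epsilon>\<close>, so every
  nonnegative predictable bet turns \<open>K t v\<close> into a nonnegative supermartingale started at 1. The
  threshold scans the grid from the left, so it can reach a bad grid point only if
  \<open>K t v \<ge> 1 / \<alpha>\<close> at this single \<open>v\<close>; Ville's inequality bounds the probability that this ever
  happens by \<open>\<alpha>\<close>, without a union bound over the grid.
\<close>

section \<open>Sigma-algebras generated by the past and by one further variable\<close>

lemma space_history [simp]: "space (history M S V t) = space M"
  unfolding history_def by (rule space_measure_of) auto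

lemma sets_history:
  "sets (history M S V t) =
     sigma_sets (space M) (\<Union>i\<in>{1..t}. {V i -` A \<inter> space M | A. A \<in> sets S})"
  unfolding history_def by (rule sets_measure_of) auto

lemma measurable_history:
  assumes "i \<in> {1..t}" "V i \<in> space M \<rightarrow> space S"
  shows "V i \<in> measurable (history M S V t) S"
proof (rule measurableI)
  fix A assume "A \<in> sets S"
  then show "V i -` A \<inter> space (history M S V t) \<in> sets (history M S V t)"
    unfolding sets_history space_history using assms(1) by (intro sigma_sets.Basic UN_I[of i]) auto
qed (use assms(2) in auto)

lemma subalgebra_history_mono:
  assumes "s \<le> t"
  shows "subalgebra (history M S V t) (history M S V s)"
  unfolding subalgebra_def sets_history space_history using assms
  by (intro conjI refl sigma_sets_mono' UN_mono) auto

lemma subalgebra_history: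
  assumes "\<And>i. i \<ge> 1 \<Longrightarrow> V i \<in> measurable M S"
  shows "subalgebra M (history M S V t)"
  unfolding subalgebra_def sets_history space_history
  using assms by (intro conjI refl sets.sigma_sets_subset) (auto intro: measurable_sets)

lemma space_adjoin [simp]: "space (adjoin F S Y) = space F"
  unfolding adjoin_def using sets.space_closed[of F] by (intro space_measure_of) auto

lemma sets_adjoin:
  "sets (adjoin F S Y) =
     sigma_sets (space F) (sets F \<union> {Y -` A \<inter> space F | A. A \<in> sets S})"
  unfolding adjoin_def using sets.space_closed[of F] by (intro sets_measure_of) auto

lemma subalgebra_adjoin_left: "subalgebra (adjoin F S Y) F"
  unfolding subalgebra_def sets_adjoin by auto

lemma measurable_adjoin:
  assumes "Y \<in> space F \<rightarrow> space S"
  shows "Y \<in> measurable (adjoin F S Y) S"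
proof (rule measurableI)
  fix A assume "A \<in> sets S"
  then show "Y -` A \<inter> space (adjoin F S Y) \<in> sets (adjoin F S Y)"
    unfolding sets_adjoin space_adjoin by (intro sigma_sets.Basic) auto
qed (use assms in auto)

lemma subalgebra_adjoin:
  assumes "subalgebra M F" "Y \<in> measurable M S"
  shows "subalgebra M (adjoin F S Y)"
proof -
  have sp: "space F = space M" and F: "sets F \<subseteq> sets M"
    using assms(1) by (auto simp: subalgebra_def)
  show ?thesis
    unfolding subalgebra_def sets_adjoin space_adjoin sp
    using F assms(2) by (intro conjI refl sets.sigma_sets_subset) (auto intro: measurable_sets)
qed

section \<open>Conditional coins and independence under nonnegative integrals\<close>

text \<open>\<open>cond_bernoulli\<close> speaks about \<open>real_cond_exp\<close>, whose integral
  identity is tied to integrable functions, whereas the weights used later are arbitrary nonnegative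
  functions. Passing to \<open>nn_cond_exp\<close> gives the identity for weights of infinite mean
  as well.\<close>

lemma (in prob_space) nn_integral_cond_bernoulli:
  assumes G: "subalgebra M G" and h [measurable]: "h \<in> borel_measurable G"
    and \<xi>: "cond_bernoulli M G \<xi> p"
  shows "(\<integral>\<^sup>+\<omega>. h \<omega> * ennreal (\<xi> \<omega>) \<partial>M) = (\<integral>\<^sup>+\<omega>. h \<omega> * ennreal (p \<omega>) \<partial>M)"
proof -
  interpret finite_measure_subalgebra M G
    using G by unfold_locales
  let ?I = "indicator {\<omega>'\<in>space M. \<xi> \<omega>' = 1} :: _ \<Rightarrow> real"
  let ?c = "nn_cond_exp M G (\<lambda>\<omega>. ennreal (?I \<omega>))"
  have [measurable]: "\<xi> \<in> borel_measurable M"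
    and vals: "\<And>\<omega>. \<omega> \<in> space M \<Longrightarrow> \<xi> \<omega> \<in> {0, 1}"
    and ae: "AE \<omega> in M. real_cond_exp M G ?I \<omega> = p \<omega>"
    using \<xi> by (auto simp: cond_bernoulli_def)
  \<comment> \<open>\<open>real_cond_exp\<close> is a difference of two \<open>enn2real\<close>
    values. The negative part of an indicator vanishes, and comparison with the conditional
    expectation of 1 keeps the positive part finite, so \<open>enn2real\<close> loses
    nothing.\<close>
  have I_neg: "(\<lambda>\<omega>. ennreal (- ?I \<omega>)) = (\<lambda>_. 0)"
    by (auto simp: indicator_def ennreal_neg fun_eq_iff)
  have "AE \<omega> in M. ?c \<omega> \<le> nn_cond_exp M G (\<lambda>_. 1) \<omega>"
    by (rule nn_cond_exp_mono) (auto simp: indicator_def)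
  moreover have "AE \<omega> in M. 1 = nn_cond_exp M G (\<lambda>_. 1) \<omega>"
    by (rule nn_cond_exp_F_meas) simp
  moreover have "AE \<omega> in M. 0 = nn_cond_exp M G (\<lambda>_. 0) \<omega>"
    by (rule nn_cond_exp_F_meas) simp
  ultimately have c: "AE \<omega> in M. ?c \<omega> = ennreal (p \<omega>)"
    using ae
  proof eventually_elim
    case (elim \<omega>)
    then have "?c \<omega> < top"
      by (metis ennreal_one_less_top order_le_less_trans)
    then show ?case
      using elim ennreal_enn2real[of "?c \<omega>"] by (simp add: real_cond_exp_def I_neg)
  qed
  have "(\<integral>\<^sup>+\<omega>. h \<omega> * ennreal (\<xi> \<omega>) \<partial>M) = (\<integral>\<^sup>+\<omega>. h \<omega> * ennreal (?I \<omega>) \<partial>M)"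
    using vals by (intro nn_integral_cong) (fastforce simp: indicator_def)
  also have "\<dots> = (\<integral>\<^sup>+\<omega>. h \<omega> * ?c \<omega> \<partial>M)"
    by (rule nn_cond_exp_intg[symmetric]) measurable
  also have "\<dots> = (\<integral>\<^sup>+\<omega>. h \<omega> * ennreal (p \<omega>) \<partial>M)"
    using c by (intro nn_integral_cong_AE) auto
  finally show ?thesis .
qed

lemma (in prob_space) indep_set_commute:
  assumes "indep_set A B"
  shows "indep_set B A"
  unfolding indep_sets2_eq
proof (intro conjI ballI)
  fix b a assume "b \<in> B" "a \<in> A"
  then show "prob (b \<inter> a) = prob b * prob a"
    using assms unfolding indep_sets2_eq by (subst Int_commute) (simp add: mult.commute)
qed (use assms in \<open>auto simp: indep_sets2_eq\<close>)

text \<open>Independence is taken between sigma-algebras, the form in which the freshness of a query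
  is given. The sigma-algebras generated by \<open>h\<close> and by \<open>g\<close> composed with
  \<open>Y\<close> lie inside \<open>F\<close> and the preimage algebra of \<open>Y\<close>, so they
  inherit independence and the mean of the product factorizes.\<close>

lemma (in prob_space) nn_integral_indep_mult:
  assumes F: "subalgebra M F" and Y: "Y \<in> measurable M S"
    and indep: "indep_set (sets (vimage_algebra (space M) Y S)) (sets F)"
    and h [measurable]: "h \<in> borel_measurable F" and g [measurable]: "g \<in> borel_measurable S"
  shows "(\<integral>\<^sup>+\<omega>. h \<omega> * g (Y \<omega>) \<partial>M) = (\<integral>\<^sup>+\<omega>. h \<omega> \<partial>M) * (\<integral>\<^sup>+\<omega>. g (Y \<omega>) \<partial>M)"
proof -
  note [measurable] = Y
  have sp: "space F = space M" using F by (simp add: subalgebra_def)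
  have hM: "h \<in> borel_measurable M" by (rule measurable_from_subalg[OF F h])
  have YV [measurable]: "Y \<in> measurable (vimage_algebra (space M) Y S) S"
    using Y by (intro measurable_vimage_algebra1 funcsetI) (rule measurable_space)
  have gY: "(\<lambda>\<omega>. g (Y \<omega>)) \<in> borel_measurable (vimage_algebra (space M) Y S)"
    by measurable
  have "sigma_sets (space M) {(\<lambda>\<omega>. g (Y \<omega>)) -` A \<inter> space M |A. A \<in> sets borel}
      \<subseteq> sets (vimage_algebra (space M) Y S)" (is "?A \<subseteq> _")
    using measurable_sets[OF gY]
    by (intro sets.sigma_sets_subset[of _ "vimage_algebra (space M) Y S", simplified]) auto
  moreover have "sigma_sets (space M) {h -` A \<inter> space M |A. A \<in> sets borel} \<subseteq> sets F" (is "?B \<subseteq> _")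
    unfolding sp[symmetric] using measurable_sets[OF h] by (intro sets.sigma_sets_subset) auto
  ultimately have "indep_set ?A ?B"
    using indep unfolding indep_sets2_eq by blast
  then have "indep_set ?B ?A"
    by (rule indep_set_commute)
  then have "indep_var borel h borel (\<lambda>\<omega>. g (Y \<omega>))"
    unfolding indep_var_eq using hM by simp
  \<comment> \<open>\<open>indep_var\<close> is independence of a family indexed by
    \<open>bool\<close>. Both targets are the same space, so the family fits the product rule, which
    expects a constant target.\<close>
  moreover have "case_bool borel borel = (\<lambda>_. borel :: ennreal measure)"
    by (auto simp: fun_eq_iff split: bool.split)
  ultimately have "(\<integral>\<^sup>+\<omega>. (\<Prod>i\<in>UNIV. case_bool h (\<lambda>\<omega>. g (Y \<omega>)) i \<omega>) \<partial>M) =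
      (\<Prod>i\<in>UNIV. \<integral>\<^sup>+\<omega>. case_bool h (\<lambda>\<omega>. g (Y \<omega>)) i \<omega> \<partial>M)"
    unfolding indep_var_def by (intro indep_vars_nn_integral) auto
  then show ?thesis
    by (simp add: UNIV_bool mult.commute)
qed

section \<open>Nonnegative supermartingales and betting\<close>

text \<open>Stop the process when it first reaches \<open>c\<close>: the stopped mass is at least
  \<open>c\<close> times the measure of the crossing set, and the supermartingale property keeps the
  total below the initial mass. That property is tested by nonnegative integrals over sets of
  \<open>F n\<close>, which avoids conditional expectations.\<close>

lemma ville_inequality:
  fixes W :: "nat \<Rightarrow> 'a \<Rightarrow> ennreal"
  assumes F: "\<And>n. subalgebra M (F n)" and F_mono: "\<And>n. subalgebra (F (Suc n)) (F n)"
    and W: "\<And>n. W n \<in> borel_measurable (F n)"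
    and super: "\<And>n A. A \<in> sets (F n) \<Longrightarrow>
      (\<integral>\<^sup>+\<omega>\<in>A. W (Suc n) \<omega> \<partial>M) \<le> (\<integral>\<^sup>+\<omega>\<in>A. W n \<omega> \<partial>M)"
  shows "c * emeasure M {\<omega>\<in>space M. \<exists>n. c \<le> W n \<omega>} \<le> (\<integral>\<^sup>+\<omega>. W 0 \<omega> \<partial>M)"
proof -
  define B where "B n = {\<omega>\<in>space M. \<forall>k\<le>n. W k \<omega> < c}" for n
  define C where "C n = {\<omega>\<in>space M. \<exists>k\<le>n. c \<le> W k \<omega>}" for n
  have sp: "space (F n) = space M" for n using F by (simp add: subalgebra_def)
  have Fmono: "subalgebra (F n) (F k)" if "k \<le> n" for k n
    using that
  proof (induction rule: dec_induct)
    case base show ?case by (simp add: subalgebra_def)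
  next
    case (step n) then show ?case using F_mono[of n] by (auto simp: subalgebra_def)
  qed
  have WF [measurable]: "W k \<in> borel_measurable (F n)" if "k \<le> n" for k n
    by (rule measurable_from_subalg[OF Fmono[OF that] W])
  have WM [measurable]: "W n \<in> borel_measurable M" for n
    by (rule measurable_from_subalg[OF F W])
  have BF: "B n \<in> sets (F n)" for n
    unfolding B_def sp[of n, symmetric] by measurable
  have [measurable]: "B n \<in> sets M" "C n \<in> sets M" for n
    unfolding B_def C_def by measurable
  \<comment> \<open>The invariant charges \<open>c\<close> for every path that has already crossed
    and keeps the current value of the paths still below \<open>c\<close>.\<close>
  have step: "c * emeasure M (C n) + (\<integral>\<^sup>+\<omega>\<in>B n. W n \<omega> \<partial>M) \<le> (\<integral>\<^sup>+\<omega>. W 0 \<omega> \<partial>M)" for n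
  proof (induction n)
    case 0
    have "c * emeasure M (C 0) + (\<integral>\<^sup>+\<omega>\<in>B 0. W 0 \<omega> \<partial>M)
        = (\<integral>\<^sup>+\<omega>. c * indicator (C 0) \<omega> + W 0 \<omega> * indicator (B 0) \<omega> \<partial>M)"
      by (subst nn_integral_add) (auto simp: nn_integral_cmult_indicator)
    also have "\<dots> \<le> (\<integral>\<^sup>+\<omega>. W 0 \<omega> \<partial>M)"
      by (intro nn_integral_mono) (auto simp: B_def C_def indicator_def)
    finally show ?case .
  next
    case (Suc n)
    let ?E = "C (Suc n) - C n"
    have "emeasure M (C (Suc n)) = emeasure M (C n) + emeasure M ?E"
      by (subst plus_emeasure) (auto simp: C_def intro!: arg_cong[where f="emeasure M"] intro: le_SucI)
    then have "c * emeasure M (C (Suc n)) + (\<integral>\<^sup>+\<omega>\<in>B (Suc n). W (Suc n) \<omega> \<partial>M)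
        = c * emeasure M (C n) + (c * emeasure M ?E + (\<integral>\<^sup>+\<omega>\<in>B (Suc n). W (Suc n) \<omega> \<partial>M))"
      by (simp add: distrib_left add.assoc)
    also have "c * emeasure M ?E + (\<integral>\<^sup>+\<omega>\<in>B (Suc n). W (Suc n) \<omega> \<partial>M)
        = (\<integral>\<^sup>+\<omega>. c * indicator ?E \<omega> + W (Suc n) \<omega> * indicator (B (Suc n)) \<omega> \<partial>M)"
      by (subst nn_integral_add) (auto simp: nn_integral_cmult_indicator)
    also have "\<dots> \<le> (\<integral>\<^sup>+\<omega>\<in>B n. W (Suc n) \<omega> \<partial>M)"
    proof (intro nn_integral_mono)
      fix \<omega>
      \<comment> \<open>A path below \<open>c\<close> up to time \<open>n\<close> either crosses
        exactly at \<open>Suc n\<close>, where its value is at least the charge \<open>c\<close>, or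
        stays below. The two cases are disjoint, which gives the pointwise bound.\<close>
      have "\<omega> \<in> ?E \<longleftrightarrow> \<omega> \<in> B n \<and> c \<le> W (Suc n) \<omega>"
        "\<omega> \<in> B (Suc n) \<longleftrightarrow> \<omega> \<in> B n \<and> \<not> c \<le> W (Suc n) \<omega>"
        unfolding B_def C_def by (fastforce simp: le_Suc_eq not_le)+
      then show "c * indicator ?E \<omega> + W (Suc n) \<omega> * indicator (B (Suc n)) \<omega>
          \<le> W (Suc n) \<omega> * indicator (B n) \<omega>"
        by (cases "\<omega> \<in> B n"; cases "c \<le> W (Suc n) \<omega>") (simp_all add: indicator_def)
    qed
    also have "\<dots> \<le> (\<integral>\<^sup>+\<omega>\<in>B n. W n \<omega> \<partial>M)"
      by (rule super[OF BF])
    finally show ?case using Suc.IH by (auto intro: order_trans add_left_mono)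
  qed
  have le: "c * emeasure M (C n) \<le> (\<integral>\<^sup>+\<omega>. W 0 \<omega> \<partial>M)" for n
    using step[of n] by (rule order_trans[rotated]) simp
  have "{\<omega>\<in>space M. \<exists>n. c \<le> W n \<omega>} = (\<Union>n. C n)"
    by (auto simp: C_def)
  moreover have "(SUP n. emeasure M (C n)) = emeasure M (\<Union>n. C n)"
    by (rule SUP_emeasure_incseq) (auto simp: C_def incseq_def intro: order_trans)
  ultimately show ?thesis
    using le by (metis (no_types, lifting) SUP_least SUP_mult_left_ennreal)
qed

text \<open>The bet \<open>b\<close> need not be integrable, so the common term \<open>\<epsilon> b\<close> can be cancelled only after
  truncating to \<open>b \<le> n\<close>.\<close>

lemma nn_integral_bet_le:
  fixes H :: "'a \<Rightarrow> ennreal" and b Z :: "'a \<Rightarrow> real"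
  assumes F: "subalgebra M F"
    and H [measurable]: "H \<in> borel_measurable F" and b [measurable]: "b \<in> borel_measurable F"
    and Z [measurable]: "Z \<in> borel_measurable M"
    and b_nonneg: "\<And>\<omega>. \<omega> \<in> space M \<Longrightarrow> 0 \<le> b \<omega>"
    and Z_nonneg: "\<And>\<omega>. \<omega> \<in> space M \<Longrightarrow> 0 \<le> Z \<omega>"
    and adm: "\<And>\<omega>. \<omega> \<in> space M \<Longrightarrow> 0 \<le> 1 + b \<omega> * (\<epsilon> - Z \<omega>)"
    and \<epsilon>: "0 \<le> \<epsilon>" "ennreal \<epsilon> \<le> r"
    and Z_int: "\<And>h. h \<in> borel_measurable F \<Longrightarrow>
      (\<integral>\<^sup>+\<omega>. h \<omega> * ennreal (Z \<omega>) \<partial>M) = r * (\<integral>\<^sup>+\<omega>. h \<omega> \<partial>M)"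
  shows "(\<integral>\<^sup>+\<omega>. H \<omega> * ennreal (1 + b \<omega> * (\<epsilon> - Z \<omega>)) \<partial>M) \<le> (\<integral>\<^sup>+\<omega>. H \<omega> \<partial>M)"
proof (cases "(\<integral>\<^sup>+\<omega>. H \<omega> \<partial>M) = \<infinity>")
  \<comment> \<open>For infinite mass of \<open>H\<close> the claim is trivial. Finite mass makes
    \<open>?J\<close> below finite, hence cancellable.\<close>
  case False
  have sp: "space F = space M" using F by (simp add: subalgebra_def)
  have [measurable]: "H \<in> borel_measurable M" "b \<in> borel_measurable M"
    using measurable_from_subalg[OF F H] measurable_from_subalg[OF F b] by simp_all
  let ?f = "\<lambda>\<omega>. ennreal (1 + b \<omega> * (\<epsilon> - Z \<omega>))"
  define T where "T n = {\<omega>\<in>space F. b \<omega> \<le> real n}" for n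
  have TF [measurable]: "T n \<in> sets F" for n unfolding T_def by measurable
  have [measurable]: "T n \<in> sets M" for n using TF F by (auto simp: subalgebra_def)
  have trunc: "(\<integral>\<^sup>+\<omega>. H \<omega> * ?f \<omega> * indicator (T n) \<omega> \<partial>M) \<le> (\<integral>\<^sup>+\<omega>. H \<omega> \<partial>M)" for n
  proof -
    let ?h = "\<lambda>\<omega>. H \<omega> * indicator (T n) \<omega>"
    let ?J = "\<integral>\<^sup>+\<omega>. ?h \<omega> * ennreal (b \<omega>) \<partial>M"
    have hle: "(\<integral>\<^sup>+\<omega>. ?h \<omega> \<partial>M) \<le> (\<integral>\<^sup>+\<omega>. H \<omega> \<partial>M)"
      by (intro nn_integral_mono) (auto simp: indicator_def)
    have "?J \<le> (\<integral>\<^sup>+\<omega>. ?h \<omega> * ennreal (real n) \<partial>M)"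
      by (intro nn_integral_mono) (auto simp: indicator_def T_def intro!: mult_left_mono ennreal_leI)
    also have "\<dots> = (\<integral>\<^sup>+\<omega>. ?h \<omega> \<partial>M) * ennreal (real n)"
      by (rule nn_integral_multc) measurable
    also have "\<dots> < \<infinity>"
      using hle False by (auto simp: ennreal_mult_less_top top_unique less_top)
    finally have J: "?J < \<infinity>" .
    \<comment> \<open>Instead of subtracting in \<open>ennreal\<close>, the loss term is moved to
      the other side: pointwise \<open>?f + b * Z\<close> is \<open>1 + \<epsilon> * b\<close>,
      while \<open>r * ?J\<close> is at least \<open>\<epsilon> * ?J\<close>.\<close>
    have "(\<integral>\<^sup>+\<omega>. ?h \<omega> * ?f \<omega> \<partial>M) + ennreal \<epsilon> * ?J
        \<le> (\<integral>\<^sup>+\<omega>. ?h \<omega> * ?f \<omega> \<partial>M) + r * ?J"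
      using \<epsilon> by (intro add_left_mono mult_right_mono) auto
    also have "r * ?J = (\<integral>\<^sup>+\<omega>. ?h \<omega> * ennreal (b \<omega>) * ennreal (Z \<omega>) \<partial>M)"
      by (rule Z_int[symmetric]) measurable
    also have "(\<integral>\<^sup>+\<omega>. ?h \<omega> * ?f \<omega> \<partial>M) + \<dots>
        = (\<integral>\<^sup>+\<omega>. ?h \<omega> * ?f \<omega> + ?h \<omega> * ennreal (b \<omega>) * ennreal (Z \<omega>) \<partial>M)"
      by (rule nn_integral_add[symmetric]) measurable
    also have "\<dots> = (\<integral>\<^sup>+\<omega>. ?h \<omega> + ennreal \<epsilon> * (?h \<omega> * ennreal (b \<omega>)) \<partial>M)"
    proof (intro nn_integral_cong)
      fix \<omega> assume \<omega>: "\<omega> \<in> space M"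
      have "?f \<omega> + ennreal (b \<omega>) * ennreal (Z \<omega>) = ennreal (1 + \<epsilon> * b \<omega>)"
        using b_nonneg[OF \<omega>] Z_nonneg[OF \<omega>] adm[OF \<omega>]
        by (simp add: ennreal_mult[symmetric] ennreal_plus[symmetric] algebra_simps del: ennreal_plus)
      also have "\<dots> = 1 + ennreal \<epsilon> * ennreal (b \<omega>)"
        using b_nonneg[OF \<omega>] \<epsilon> by (simp add: ennreal_mult)
      finally have eq: "?f \<omega> + ennreal (b \<omega>) * ennreal (Z \<omega>) = 1 + ennreal \<epsilon> * ennreal (b \<omega>)" .
      show "?h \<omega> * ?f \<omega> + ?h \<omega> * ennreal (b \<omega>) * ennreal (Z \<omega>)
          = ?h \<omega> + ennreal \<epsilon> * (?h \<omega> * ennreal (b \<omega>))"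
        using arg_cong[OF eq, of "\<lambda>x. ?h \<omega> * x"] by (simp add: distrib_left ac_simps)
    qed
    also have "\<dots> = (\<integral>\<^sup>+\<omega>. ?h \<omega> \<partial>M) + ennreal \<epsilon> * ?J"
      by (simp add: nn_integral_add nn_integral_cmult)
    finally have "(\<integral>\<^sup>+\<omega>. ?h \<omega> * ?f \<omega> \<partial>M) \<le> (\<integral>\<^sup>+\<omega>. ?h \<omega> \<partial>M)"
      using J by (auto simp: ennreal_add_left_cancel_le add.commute ennreal_mult_eq_top_iff)
    also note hle
    finally show ?thesis by (simp add: ac_simps)
  qed
  \<comment> \<open>Since \<open>b\<close> is real-valued, every point lies in some
    \<open>T n\<close>, and these sets increase with \<open>n\<close>; monotone convergence removes
    the truncation.\<close>
  have "(\<integral>\<^sup>+\<omega>. H \<omega> * ?f \<omega> \<partial>M) = (\<integral>\<^sup>+\<omega>. (SUP n. H \<omega> * ?f \<omega> * indicator (T n) \<omega>) \<partial>M)"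
  proof (intro nn_integral_cong)
    fix \<omega> assume "\<omega> \<in> space M"
    obtain n where "b \<omega> \<le> real n" using real_arch_simple by blast
    with \<open>\<omega> \<in> space M\<close> have "\<omega> \<in> T n" by (simp add: T_def sp)
    then show "H \<omega> * ?f \<omega> = (SUP n. H \<omega> * ?f \<omega> * indicator (T n) \<omega>)"
      by (intro antisym SUP_upper2[of n] SUP_least) (auto simp: indicator_def)
  qed
  also have "\<dots> = (SUP n. \<integral>\<^sup>+\<omega>. H \<omega> * ?f \<omega> * indicator (T n) \<omega> \<partial>M)"
  proof (rule nn_integral_monotone_convergence_SUP)
    show "incseq (\<lambda>n \<omega>. H \<omega> * ?f \<omega> * indicator (T n) \<omega>)"
      by (auto simp: incseq_def le_fun_def T_def split: split_indicator)
  qed measurable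
  also have "\<dots> \<le> (\<integral>\<^sup>+\<omega>. H \<omega> \<partial>M)"
    using trunc by (rule SUP_least)
  finally show ?thesis .
qed simp

section \<open>Closed forms of the risk and of the threshold\<close>

text \<open>The coin can come up False only when the score is below the threshold, and then with
  probability \<open>1 - r\<close>. This separates the exploration rate from a quantity that depends
  only on the joint law of loss and score.\<close>

lemma risk_eq:
  assumes "0 \<le> r" "r \<le> 1"
  shows "risk M L U r v = (1 - r) * (\<integral>\<omega>. L \<omega> * of_bool (U \<omega> < v) \<partial>M)"
proof -
  have "measure_pmf.expectation (bernoulli_pmf (query_prob r v (U \<omega>))) (\<lambda>b. L \<omega> * of_bool (b = False))
      = (1 - r) * (L \<omega> * of_bool (U \<omega> < v))" for \<omega>
    using assms by (cases "U \<omega> < v") (auto simp: query_prob_def)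
  then show ?thesis unfolding risk_def by (simp only: integral_mult_right_zero)
qed

text \<open>Replaces the maximum over a varying set of grid points by one over a fixed index set, which makes
  the threshold visibly measurable.\<close>

lemma threshold_eq_Max:
  assumes "N \<ge> 1" "u 1 = 0" "\<And>i. i \<in> {1..N} \<Longrightarrow> 0 \<le> u i"
  shows "threshold u N \<alpha> k =
    Max ((\<lambda>i. if \<forall>j\<in>{1..i}. k (u j) \<ge> 1 / \<alpha> then u i else 0) ` {1..N})"
proof -
  let ?P = "\<lambda>i. \<forall>j\<in>{1..i}. k (u j) \<ge> 1 / \<alpha>"
  let ?g = "\<lambda>i. if ?P i then u i else 0"
  define S where "S = {u i | i. i \<in> {1..N} \<and> ?P i}"
  have t: "threshold u N \<alpha> k = (if S = {} then 0 else Max S)"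
    unfolding threshold_def S_def Let_def ..
  have S: "finite S" unfolding S_def by simp
  show ?thesis
  proof (cases "S = {}")
    case True
    then have "?g ` {1..N} = {0}"
      using assms(1) by (fastforce simp: S_def)
    then show ?thesis using True t by simp
  next
    case False
    then obtain i where i: "Max S = u i" "i \<in> {1..N}" "?P i"
      using Max_in[OF S] unfolding S_def by blast
    \<comment> \<open>The zeros standing for disqualified grid points cannot exceed
      \<open>Max S\<close>, which is itself a nonnegative grid value.\<close>
    have "Max (?g ` {1..N}) = Max S"
    proof (rule Max_eqI)
      show "Max S \<in> ?g ` {1..N}" using i by force
      fix y assume "y \<in> ?g ` {1..N}"
      then obtain m where m: "m \<in> {1..N}" "y = ?g m" by blast
      show "y \<le> Max S"
      proof (cases "?P m")
        case True then show ?thesis using m S by (auto simp: S_def intro!: Max_ge)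
      next
        case False
        then have "y = 0" using m(2) by (simp only: if_False)
        then show ?thesis using i(1) assms(3)[OF i(2)] by simp
      qed
    qed simp
    then show ?thesis using False t by simp
  qed
qed

theorem theorem4p2:
  fixes M :: "'w measure" and MX :: "'x measure" and MY :: "'y measure"
    and f ft :: "'x \<Rightarrow> 'y" and l :: "'y \<times> 'y \<Rightarrow> real" and score :: "'x \<Rightarrow> real"
    and X :: "nat \<Rightarrow> 'w \<Rightarrow> 'x"
    and u :: "nat \<Rightarrow> real" and N T_warm :: nat
    and \<rho>_warm \<rho>_deploy \<rho>_min \<alpha> \<epsilon> :: real and \<rho> :: "nat \<Rightarrow> real"
    and L U \<pi> \<xi> uhat :: "nat \<Rightarrow> 'w \<Rightarrow> real"
    and Z D K bet :: "nat \<Rightarrow> real \<Rightarrow> 'w \<Rightarrow> real"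
    and F :: "nat \<Rightarrow> 'w measure"
  assumes prob_space: "prob_space M"
    \<comment> \<open>models, loss and uncertainty score\<close>
    and f: "f \<in> measurable MX MY" and ft: "ft \<in> measurable MX MY"
    and l: "l \<in> borel_measurable (MY \<Otimes>\<^sub>M MY)"
    and l_range: "\<And>p. p \<in> space (MY \<Otimes>\<^sub>M MY) \<Longrightarrow> l p \<in> {0..1}"
    and score: "score \<in> borel_measurable MX"
    and score_range: "\<And>x. x \<in> space MX \<Longrightarrow> score x \<in> {0..1}"
    \<comment> \<open>i.i.d. queries\<close>
    and X_indep: "prob_space.indep_vars M (\<lambda>_. MX) X {1..}"
    and X_ident: "\<And>t. t \<ge> 1 \<Longrightarrow> distr M MX (X t) = distr M MX (X 1)"
    and L: "\<And>t \<omega>. L t \<omega> = l (ft (X t \<omega>), f (X t \<omega>))"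
    and U: "\<And>t \<omega>. U t \<omega> = score (X t \<omega>)"
    \<comment> \<open>grid\<close>
    and N: "N \<ge> 2" and u_first: "u 1 = 0" and u_last: "u N = 1"
    and u_mono: "strict_mono_on {1..N} u"
    \<comment> \<open>exploration probabilities and levels\<close>
    and rates: "0 < \<rho>_deploy" "\<rho>_deploy \<le> \<rho>_warm" "\<rho>_warm < 1"
    and \<rho>: "\<rho> = two_stage_rate \<rho>_warm \<rho>_deploy T_warm"
    and \<rho>_min: "\<rho>_min = min_rate \<rho>"
    and \<alpha>: "0 < \<alpha>" "\<alpha> < 1" and \<epsilon>: "0 < \<epsilon>" "\<epsilon> < 1"
    \<comment> \<open>the filtration of observations and the randomized queries\<close>
    and F: "\<And>t. F t = history M (MX \<Otimes>\<^sub>M MY \<Otimes>\<^sub>M borel \<Otimes>\<^sub>M borel)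
              (\<lambda>i \<omega>. (X i \<omega>, ft (X i \<omega>), L i \<omega> * \<xi> i \<omega>, U i \<omega>)) t"
    and X_fresh: "\<And>t. t \<ge> 1 \<Longrightarrow>
          prob_space.indep_set M (sets (vimage_algebra (space M) (X t) MX)) (sets (F (t - 1)))"
    and \<pi>: "\<And>t \<omega>. t \<ge> 1 \<Longrightarrow> \<omega> \<in> space M \<Longrightarrow> \<pi> t \<omega> = query_prob (\<rho> t) (uhat (t - 1) \<omega>) (U t \<omega>)"
    and \<xi>: "\<And>t. t \<ge> 1 \<Longrightarrow> cond_bernoulli M (adjoin (F (t - 1)) MX (X t)) (\<xi> t) (\<pi> t)"
    \<comment> \<open>bets and wealth\<close>
    and Z: "\<And>t v \<omega>. t \<ge> 1 \<Longrightarrow> v \<in> u ` {1..N} \<Longrightarrow> \<omega> \<in> space M \<Longrightarrow>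
          Z t v \<omega> = (1 - \<rho>_min) * (L t \<omega> / \<pi> t \<omega>) * \<xi> t \<omega> * of_bool (U t \<omega> < v)"
    and D: "\<And>t v \<omega>. t \<ge> 1 \<Longrightarrow> v \<in> u ` {1..N} \<Longrightarrow> \<omega> \<in> space M \<Longrightarrow> D t v \<omega> = \<epsilon> - Z t v \<omega>"
    and bet_predictable: "\<And>t v. t \<ge> 1 \<Longrightarrow> v \<in> u ` {1..N} \<Longrightarrow> bet t v \<in> borel_measurable (F (t - 1))"
    and bet_nonneg: "\<And>t v \<omega>. t \<ge> 1 \<Longrightarrow> v \<in> u ` {1..N} \<Longrightarrow> \<omega> \<in> space M \<Longrightarrow> bet t v \<omega> \<ge> 0"
    and bet_admissible: "\<And>t v \<omega>. t \<ge> 1 \<Longrightarrow> v \<in> u ` {1..N} \<Longrightarrow> \<omega> \<in> space M \<Longrightarrow>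
          1 + bet t v \<omega> * D t v \<omega> \<ge> 0"
    and K_0: "\<And>v \<omega>. v \<in> u ` {1..N} \<Longrightarrow> \<omega> \<in> space M \<Longrightarrow> K 0 v \<omega> = 1"
    and K_step: "\<And>t v \<omega>. t \<ge> 1 \<Longrightarrow> v \<in> u ` {1..N} \<Longrightarrow> \<omega> \<in> space M \<Longrightarrow>
          K t v \<omega> = K (t - 1) v \<omega> * (1 + bet t v \<omega> * D t v \<omega>)"
    \<comment> \<open>thresholds\<close>
    and uhat_0: "\<And>\<omega>. \<omega> \<in> space M \<Longrightarrow> uhat 0 \<omega> = 0"
    and uhat: "\<And>t \<omega>. t \<ge> 1 \<Longrightarrow> \<omega> \<in> space M \<Longrightarrow> uhat t \<omega> = threshold u N \<alpha> (\<lambda>v. K t v \<omega>)"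
  shows "measure M {\<omega> \<in> space M. \<forall>t\<ge>1. risk M (L t) (U t) (\<rho> t) (uhat t \<omega>) \<le> \<epsilon>} \<ge> 1 - \<alpha>"
proof -
  interpret prob_space M by (rule prob_space)
  let ?grid = "u ` {1..N}"
  define S where "S = MX \<Otimes>\<^sub>M MY \<Otimes>\<^sub>M (borel :: real measure) \<Otimes>\<^sub>M (borel :: real measure)"
  define V where "V i \<omega> = (X i \<omega>, ft (X i \<omega>), L i \<omega> * \<xi> i \<omega>, U i \<omega>)" for i \<omega>
  define g where "g x = l (ft x, f x)" for x
  define \<phi> where "\<phi> v x = (if score x < v then g x else 0)" for v x
  \<comment> \<open>Taken under the law of the first query; identical distribution lets this one
    function serve every time \<open>t\<close>.\<close>
  define \<theta> where "\<theta> v = (\<integral>x. \<phi> v x \<partial>distr M MX (X 1))" for v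
  define R where "R v = (1 - \<rho>_min) * \<theta> v" for v
  have F_eq: "F t = history M S V t" for t
    by (simp add: F S_def V_def[abs_def])
  have spF: "space (F t) = space M" for t
    by (simp add: F_eq)
  have X_meas: "X t \<in> measurable M MX" if "t \<ge> 1" for t
    using X_indep that by (auto simp: indep_vars_def)
  have X_space: "X t \<omega> \<in> space MX" if "t \<ge> 1" "\<omega> \<in> space M" for t \<omega>
    using measurable_space[OF X_meas] that by auto
  have \<xi>_meas: "\<xi> t \<in> borel_measurable M" if "t \<ge> 1" for t
    using \<xi>[OF that] by (simp add: cond_bernoulli_def)
  have \<xi>_vals: "\<xi> t \<omega> = 0 \<or> \<xi> t \<omega> = 1" if "t \<ge> 1" "\<omega> \<in> space M" for t \<omega>
    using \<xi>[OF that(1)] that(2) by (auto simp: cond_bernoulli_def)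

  \<comment> \<open>Exploration rates and their infimum\<close>
  have \<rho>_ge: "\<rho>_deploy \<le> \<rho> t" and \<rho>_lt: "\<rho> t < 1" for t
    using rates by (auto simp: \<rho> two_stage_rate_def)
  have \<rho>_min_eq: "\<rho>_min = \<rho>_deploy"
  proof -
    \<comment> \<open>The infimum is attained at the first deployment time, which is at least 1 even
      if \<open>T_warm\<close> is 0.\<close>
    have "\<rho> (Suc T_warm) = \<rho>_deploy" by (simp add: \<rho> two_stage_rate_def)
    moreover have "bdd_below (\<rho> ` {1..})" using \<rho>_ge by (intro bdd_belowI2) auto
    ultimately have "(INF t\<in>{1..}. \<rho> t) \<le> \<rho>_deploy"
      by (intro cINF_lower2[where x="Suc T_warm"]) auto
    moreover have "\<rho>_deploy \<le> (INF t\<in>{1..}. \<rho> t)"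
      using \<rho>_ge by (intro cINF_greatest) auto
    ultimately show ?thesis
      unfolding \<rho>_min min_rate_def by (rule antisym)
  qed
  have \<rho>_pos: "0 < \<rho> t" for t using \<rho>_ge[of t] rates by simp
  have \<rho>_min_bounds: "0 < \<rho>_min" "\<rho>_min < 1" "\<And>t. \<rho>_min \<le> \<rho> t"
    using rates \<rho>_ge by (auto simp: \<rho>_min_eq)

  \<comment> \<open>Law of a single query and the risk at each time\<close>
  note [measurable] = f ft l score
  have g_meas [measurable]: "g \<in> borel_measurable MX"
    unfolding g_def[abs_def] by measurable
  have g_range: "0 \<le> g x" "g x \<le> 1" if "x \<in> space MX" for x
    using l_range[of "(ft x, f x)"] measurable_space[OF f that] measurable_space[OF ft that]
    by (auto simp: g_def space_pair_measure)
  have L_eq: "L t \<omega> = g (X t \<omega>)" for t \<omega> by (simp add: L g_def)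
  have \<phi>_meas [measurable]: "\<phi> v \<in> borel_measurable MX" for v
    unfolding \<phi>_def[abs_def] by measurable
  have \<phi>_range: "0 \<le> \<phi> v x" "\<phi> v x \<le> 1" if "x \<in> space MX" for v x
    using g_range[OF that] by (auto simp: \<phi>_def)

  have X1: "X 1 \<in> measurable M MX" by (rule X_meas) simp
  interpret QX: prob_space "distr M MX (X 1)"
    by (rule prob_space_distr[OF X1])
  have \<phi>_int: "integrable (distr M MX (X 1)) (\<phi> v)" for v
    using \<phi>_range by (intro QX.integrable_const_bound[of _ 1]) auto
  have \<theta>_nonneg: "0 \<le> \<theta> v" for v
    unfolding \<theta>_def using \<phi>_range by (intro integral_nonneg_AE) auto
  have \<theta>_mono: "\<theta> v \<le> \<theta> w" if "v \<le> w" for v w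
    unfolding \<theta>_def using that \<phi>_int g_range
    by (intro integral_mono) (auto simp: \<phi>_def)
  \<comment> \<open>Scores are nonnegative, so none lies strictly below 0. This later makes the
    default threshold 0 safe.\<close>
  have \<theta>_0: "\<theta> 0 = 0"
  proof -
    have "\<theta> 0 = (\<integral>x. 0 \<partial>distr M MX (X 1))"
      unfolding \<theta>_def using score_range
      by (intro Bochner_Integration.integral_cong) (force simp: \<phi>_def)+
    then show ?thesis by simp
  qed
  have \<theta>_X: "(\<integral>\<^sup>+\<omega>. ennreal (\<phi> v (X t \<omega>)) \<partial>M) = ennreal (\<theta> v)" if "t \<ge> 1" for t v
  proof -
    have "(\<integral>\<^sup>+\<omega>. ennreal (\<phi> v (X t \<omega>)) \<partial>M) = (\<integral>\<^sup>+x. ennreal (\<phi> v x) \<partial>distr M MX (X t))"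
      using X_meas[OF that] by (intro nn_integral_distr[symmetric]) simp_all
    also have "\<dots> = (\<integral>\<^sup>+x. ennreal (\<phi> v x) \<partial>distr M MX (X 1))"
      by (simp add: X_ident[OF that])
    also have "\<dots> = ennreal (\<theta> v)"
      unfolding \<theta>_def using \<phi>_range \<phi>_int by (intro nn_integral_eq_integral) auto
    finally show ?thesis .
  qed
  have risk: "risk M (L t) (U t) (\<rho> t) v = (1 - \<rho> t) * \<theta> v" if "t \<ge> 1" for t v
  proof -
    have "(\<integral>\<omega>. L t \<omega> * of_bool (U t \<omega> < v) \<partial>M) = (\<integral>\<omega>. \<phi> v (X t \<omega>) \<partial>M)"
      by (intro Bochner_Integration.integral_cong) (auto simp: L_eq U \<phi>_def)
    also have "\<dots> = (\<integral>x. \<phi> v x \<partial>distr M MX (X t))"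
      by (rule integral_distr[symmetric]) (use X_meas[OF that] in simp_all)
    also have "\<dots> = \<theta> v"
      by (simp add: X_ident[OF that] \<theta>_def)
    finally show ?thesis
      using \<rho>_pos[of t] \<rho>_lt[of t] by (subst risk_eq) auto
  qed
  have risk_le: "risk M (L t) (U t) (\<rho> t) v \<le> R v" if "t \<ge> 1" for t v
    unfolding risk[OF that] R_def using \<rho>_min_bounds(3)[of t] \<theta>_nonneg[of v]
    by (intro mult_right_mono) auto

  \<comment> \<open>Adaptedness of wealth and thresholds\<close>
  have V_meas: "V t \<in> measurable M S" if "t \<ge> 1" for t
    using X_meas[OF that] \<xi>_meas[OF that] unfolding V_def[abs_def] S_def L_eq U by measurable
  have F_sub: "subalgebra M (F t)" for t
    unfolding F_eq by (rule subalgebra_history) (rule V_meas)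
  have F_mono: "subalgebra (F t) (F s)" if "s \<le> t" for s t
    unfolding F_eq using that by (rule subalgebra_history_mono)
  have V_F: "V t \<in> measurable (F t) S" if "t \<ge> 1" for t
    unfolding F_eq using that measurable_space[OF V_meas[OF that]]
    by (intro measurable_history) auto
  have X_F: "X t \<in> measurable (F t) MX" if "t \<ge> 1" for t
  proof -
    have "(\<lambda>\<omega>. fst (V t \<omega>)) \<in> measurable (F t) MX"
      using V_F[OF that] unfolding S_def by measurable
    then show ?thesis by (simp add: V_def)
  qed
  have L\<xi>_F: "(\<lambda>\<omega>. L t \<omega> * \<xi> t \<omega>) \<in> borel_measurable (F t)" if "t \<ge> 1" for t
  proof -
    have "(\<lambda>\<omega>. fst (snd (snd (V t \<omega>)))) \<in> borel_measurable (F t)"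
      using V_F[OF that] unfolding S_def by measurable
    then show ?thesis by (simp add: V_def)
  qed

  have u_nonneg: "0 \<le> u i" if "i \<in> {1..N}" for i
    using strict_mono_onD[OF u_mono, of 1 i] that N u_first by (cases "i = 1") auto
  have uhat_eq: "uhat t \<omega> =
      Max ((\<lambda>i. if \<forall>j\<in>{1..i}. K t (u j) \<omega> \<ge> 1 / \<alpha> then u i else 0) ` {1..N})"
    if "t \<ge> 1" "\<omega> \<in> space M" for t \<omega>
    unfolding uhat[OF that] using N u_nonneg by (intro threshold_eq_Max u_first) auto
  \<comment> \<open>Wealth and threshold need a joint induction: the wealth at \<open>Suc t\<close>
    depends on \<open>uhat t\<close> through the query probability, and \<open>uhat (Suc t)\<close>
    is read off that wealth.\<close>
  have K_uhat_F: "(\<forall>v\<in>?grid. K t v \<in> borel_measurable (F t)) \<and> uhat t \<in> borel_measurable (F t)" for t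
  proof (induction t)
    case 0
    have "K 0 v \<in> borel_measurable (F 0) \<longleftrightarrow> (\<lambda>_. 1 :: real) \<in> borel_measurable (F 0)" if "v \<in> ?grid" for v
      using K_0[OF that] by (intro measurable_cong) (simp add: spF)
    moreover have "uhat 0 \<in> borel_measurable (F 0) \<longleftrightarrow> (\<lambda>_. 0 :: real) \<in> borel_measurable (F 0)"
      using uhat_0 by (intro measurable_cong) (simp add: spF)
    ultimately show ?case by simp
  next
    case (Suc t)
    have K: "K (Suc t) v \<in> borel_measurable (F (Suc t))" if v: "v \<in> ?grid" for v
    proof -
      have "K t v \<in> borel_measurable (F t)" "uhat t \<in> borel_measurable (F t)"
        "bet (Suc t) v \<in> borel_measurable (F t)"
        using Suc.IH v bet_predictable[of "Suc t" v] by auto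
      note [measurable] = this[THEN measurable_from_subalg[OF F_mono[OF le_SucI[OF order_refl]]]]
      note [measurable] = X_F[of "Suc t", simplified] L\<xi>_F[of "Suc t", simplified]
      \<comment> \<open>The history records the coin only through \<open>L * \<xi>\<close>, so the
        update is rearranged until \<open>\<xi>\<close> occurs in that product alone.\<close>
      have "K (Suc t) v \<omega> = K t v \<omega> * (1 + bet (Suc t) v \<omega> * (\<epsilon> - (1 - \<rho>_min) *
          (L (Suc t) \<omega> * \<xi> (Suc t) \<omega>) /
          (if score (X (Suc t) \<omega>) \<ge> uhat t \<omega> then 1 else \<rho> (Suc t)) *
          (if score (X (Suc t) \<omega>) < v then 1 else 0)))" (is "_ = ?k \<omega>")
        if "\<omega> \<in> space (F (Suc t))" for \<omega>
        using that v
        by (simp add: spF K_step D Z \<pi> query_prob_def U of_bool_def not_le mult_ac)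
      moreover have "?k \<in> borel_measurable (F (Suc t))" by measurable
      ultimately show ?thesis by (subst measurable_cong) auto
    qed
    have "uhat (Suc t) \<in> borel_measurable (F (Suc t)) \<longleftrightarrow>
      (\<lambda>\<omega>. Max ((\<lambda>i. if \<forall>j\<in>{1..i}. K (Suc t) (u j) \<omega> \<ge> 1 / \<alpha> then u i else 0) ` {1..N}))
        \<in> borel_measurable (F (Suc t))"
      by (intro measurable_cong uhat_eq) (auto simp: spF)
    also have "\<dots>"
    proof (intro borel_measurable_Max)
      fix i assume i: "i \<in> {1..N}"
      have [measurable]: "K (Suc t) (u j) \<in> borel_measurable (F (Suc t))" if "j \<in> {1..i}" for j
        using K[of "u j"] that i by auto
      have "{\<omega> \<in> space (F (Suc t)). \<forall>j\<in>{1..i}. K (Suc t) (u j) \<omega> \<ge> 1 / \<alpha>} \<in> sets (F (Suc t))"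
        using i by (intro sets.sets_Collect_finite_All') (auto intro!: borel_measurable_le)
      then show "(\<lambda>\<omega>. if \<forall>j\<in>{1..i}. K (Suc t) (u j) \<omega> \<ge> 1 / \<alpha> then u i else 0)
          \<in> borel_measurable (F (Suc t))"
        by (intro measurable_If) auto
    qed simp
    finally show ?case using K by blast
  qed
  then have K_F: "\<And>t v. v \<in> ?grid \<Longrightarrow> K t v \<in> borel_measurable (F t)"
    and uhat_F: "\<And>t. uhat t \<in> borel_measurable (F t)"
    by auto

  \<comment> \<open>Conditional mean of the weighted losses\<close>
  have K_nonneg: "0 \<le> K t v \<omega>" if "v \<in> ?grid" "\<omega> \<in> space M" for t v \<omega>
    using that by (induction t) (simp_all add: K_0 K_step bet_admissible)
  have \<pi>_pos: "0 < \<pi> t \<omega>" if "t \<ge> 1" "\<omega> \<in> space M" for t \<omega>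
    using \<rho>_pos[of t] by (simp add: \<pi>[OF that] query_prob_def)

  have Z_eq: "Z t v \<omega> = (1 - \<rho>_min) * \<phi> v (X t \<omega>) / \<pi> t \<omega> * \<xi> t \<omega>"
    if "t \<ge> 1" "v \<in> ?grid" "\<omega> \<in> space M" for t v \<omega>
    using Z[OF that] by (simp add: L_eq U \<phi>_def)
  have Z_nonneg: "0 \<le> Z t v \<omega>" if "t \<ge> 1" "v \<in> ?grid" "\<omega> \<in> space M" for t v \<omega>
    unfolding Z_eq[OF that]
    using \<rho>_min_bounds \<phi>_range(1)[OF X_space[OF that(1,3)], of v] \<pi>_pos[OF that(1,3)] \<xi>_vals[OF that(1,3)]
    by auto
  \<comment> \<open>The past together with the next query. With respect to it the next coin has mean
    \<open>\<pi> (Suc t)\<close>, which is itself measurable there.\<close>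
  let ?G = "\<lambda>t. adjoin (F t) MX (X (Suc t))"
  have G_sub: "subalgebra M (?G t)" for t
    by (intro subalgebra_adjoin F_sub X_meas) simp
  have X_G [measurable]: "X (Suc t) \<in> measurable (?G t) MX" for t
    by (rule measurable_adjoin) (use X_space in \<open>auto simp: spF\<close>)
  have \<pi>_G [measurable]: "\<pi> (Suc t) \<in> borel_measurable (?G t)" for t
  proof -
    note [measurable] = measurable_from_subalg[OF subalgebra_adjoin_left uhat_F]
    have "(\<lambda>\<omega>. if score (X (Suc t) \<omega>) \<ge> uhat t \<omega> then 1 else \<rho> (Suc t)) \<in> borel_measurable (?G t)"
      by measurable
    then show ?thesis
      by (subst measurable_cong[where g="\<lambda>\<omega>. if score (X (Suc t) \<omega>) \<ge> uhat t \<omega> then 1 else \<rho> (Suc t)"])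
         (auto simp: spF \<pi> query_prob_def U)
  qed
  have Z_M: "Z (Suc t) v \<in> borel_measurable M" if v: "v \<in> ?grid" for t v
  proof -
    note [measurable] = X_meas[of "Suc t", simplified] \<xi>_meas[of "Suc t", simplified]
      measurable_from_subalg[OF G_sub \<pi>_G]
    have "(\<lambda>\<omega>. (1 - \<rho>_min) * \<phi> v (X (Suc t) \<omega>) / \<pi> (Suc t) \<omega> * \<xi> (Suc t) \<omega>) \<in> borel_measurable M"
      by measurable
    then show ?thesis by (subst measurable_cong[OF Z_eq]) (use v in auto)
  qed
  \<comment> \<open>Quantifying over all weights \<open>h\<close> says that the conditional mean of
    \<open>Z (Suc t) v\<close> given \<open>F t\<close> is \<open>R v\<close>. Conditioning first on
    \<open>?G t\<close> replaces \<open>\<xi>\<close> by \<open>\<pi>\<close> and cancels the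
    denominator; freshness of the query then splits off \<open>h\<close>.\<close>
  have Z_int: "(\<integral>\<^sup>+\<omega>. h \<omega> * ennreal (Z (Suc t) v \<omega>) \<partial>M) = ennreal (R v) * (\<integral>\<^sup>+\<omega>. h \<omega> \<partial>M)"
    if h: "h \<in> borel_measurable (F t)" and v: "v \<in> ?grid" for h t v
  proof -
    let ?a = "\<lambda>\<omega>. (1 - \<rho>_min) * \<phi> v (X (Suc t) \<omega>) / \<pi> (Suc t) \<omega>"
    note [measurable] = measurable_from_subalg[OF subalgebra_adjoin_left h]
    have ha_G: "(\<lambda>\<omega>. h \<omega> * ennreal (?a \<omega>)) \<in> borel_measurable (?G t)"
      by measurable
    have a_nonneg: "0 \<le> ?a \<omega>" if "\<omega> \<in> space M" for \<omega>
      using \<rho>_min_bounds \<phi>_range(1)[OF X_space[of "Suc t", OF _ that], of v] \<pi>_pos[of "Suc t", OF _ that]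
      by auto
    have "(\<integral>\<^sup>+\<omega>. h \<omega> * ennreal (Z (Suc t) v \<omega>) \<partial>M)
        = (\<integral>\<^sup>+\<omega>. (h \<omega> * ennreal (?a \<omega>)) * ennreal (\<xi> (Suc t) \<omega>) \<partial>M)"
    proof (intro nn_integral_cong)
      fix \<omega> assume \<omega>: "\<omega> \<in> space M"
      have "ennreal (Z (Suc t) v \<omega>) = ennreal (?a \<omega>) * ennreal (\<xi> (Suc t) \<omega>)"
        unfolding ennreal_mult'[OF a_nonneg[OF \<omega>], symmetric] using v \<omega> by (subst Z_eq) auto
      then show "h \<omega> * ennreal (Z (Suc t) v \<omega>) = (h \<omega> * ennreal (?a \<omega>)) * ennreal (\<xi> (Suc t) \<omega>)"
        by (simp add: mult.assoc)
    qed
    also have "\<dots> = (\<integral>\<^sup>+\<omega>. (h \<omega> * ennreal (?a \<omega>)) * ennreal (\<pi> (Suc t) \<omega>) \<partial>M)"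
      using \<xi>[of "Suc t"] by (intro nn_integral_cond_bernoulli[OF G_sub ha_G]) simp
    also have "\<dots> = (\<integral>\<^sup>+\<omega>. h \<omega> * ennreal ((1 - \<rho>_min) * \<phi> v (X (Suc t) \<omega>)) \<partial>M)"
    proof (intro nn_integral_cong)
      fix \<omega> assume \<omega>: "\<omega> \<in> space M"
      have "?a \<omega> * \<pi> (Suc t) \<omega> = (1 - \<rho>_min) * \<phi> v (X (Suc t) \<omega>)"
        using \<pi>_pos[of "Suc t" \<omega>] \<omega> by simp
      then show "h \<omega> * ennreal (?a \<omega>) * ennreal (\<pi> (Suc t) \<omega>)
          = h \<omega> * ennreal ((1 - \<rho>_min) * \<phi> v (X (Suc t) \<omega>))"
        using a_nonneg[OF \<omega>] by (simp add: mult.assoc flip: ennreal_mult')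
    qed
    also have "\<dots> = (\<integral>\<^sup>+\<omega>. h \<omega> \<partial>M) * (\<integral>\<^sup>+\<omega>. ennreal ((1 - \<rho>_min) * \<phi> v (X (Suc t) \<omega>)) \<partial>M)"
      using X_fresh[of "Suc t"] h
      by (intro nn_integral_indep_mult[OF F_sub X_meas, of "Suc t" t h "\<lambda>x. ennreal ((1 - \<rho>_min) * \<phi> v x)"]) auto
    also have "(\<integral>\<^sup>+\<omega>. ennreal ((1 - \<rho>_min) * \<phi> v (X (Suc t) \<omega>)) \<partial>M) = ennreal (R v)"
    proof -
      note [measurable] = X_meas[of "Suc t", simplified]
      have "(\<integral>\<^sup>+\<omega>. ennreal ((1 - \<rho>_min) * \<phi> v (X (Suc t) \<omega>)) \<partial>M)
          = ennreal (1 - \<rho>_min) * (\<integral>\<^sup>+\<omega>. ennreal (\<phi> v (X (Suc t) \<omega>)) \<partial>M)"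
        using \<rho>_min_bounds by (simp add: ennreal_mult' nn_integral_cmult)
      then show ?thesis
        using \<rho>_min_bounds by (simp add: \<theta>_X R_def ennreal_mult')
    qed
    finally show ?thesis by (simp add: mult.commute)
  qed

  \<comment> \<open>Ville's bound at a bad grid point\<close>
  have crossing: "prob {\<omega>\<in>space M. \<exists>t. 1 / \<alpha> \<le> K t v \<omega>} \<le> \<alpha>"
    if v: "v \<in> ?grid" and bad: "\<epsilon> < R v" for v
  proof -
    \<comment> \<open>The weight given to \<open>nn_integral_bet_le\<close> is the current wealth
      restricted to \<open>A\<close>, which is determined by \<open>F t\<close>. Badness of
      \<open>v\<close> supplies its condition that the mean of \<open>Z\<close> is at least
      \<open>\<epsilon>\<close>.\<close>
    have super: "(\<integral>\<^sup>+\<omega>\<in>A. ennreal (K (Suc t) v \<omega>) \<partial>M) \<le> (\<integral>\<^sup>+\<omega>\<in>A. ennreal (K t v \<omega>) \<partial>M)"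
      if [measurable]: "A \<in> sets (F t)" for A t
    proof -
      note [measurable] = K_F[OF v, of t]
      have "(\<integral>\<^sup>+\<omega>\<in>A. ennreal (K (Suc t) v \<omega>) \<partial>M) =
          (\<integral>\<^sup>+\<omega>. (ennreal (K t v \<omega>) * indicator A \<omega>) *
            ennreal (1 + bet (Suc t) v \<omega> * (\<epsilon> - Z (Suc t) v \<omega>)) \<partial>M)"
        using v K_nonneg[OF v, of _ t]
        by (intro nn_integral_cong) (simp add: K_step D ennreal_mult' mult_ac)
      also have "\<dots> \<le> (\<integral>\<^sup>+\<omega>\<in>A. ennreal (K t v \<omega>) \<partial>M)"
      proof (rule nn_integral_bet_le[OF F_sub[of t] _ _ Z_M[OF v], where r="ennreal (R v)"])
        show "bet (Suc t) v \<in> borel_measurable (F t)"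
          using bet_predictable[of "Suc t" v] v by simp
        show "0 \<le> 1 + bet (Suc t) v \<omega> * (\<epsilon> - Z (Suc t) v \<omega>)" if "\<omega> \<in> space M" for \<omega>
          using bet_admissible[of "Suc t" v \<omega>] D[of "Suc t" v \<omega>] v that by simp
        show "ennreal \<epsilon> \<le> ennreal (R v)" using bad by (intro ennreal_leI) simp
      qed (use v \<epsilon> bet_nonneg Z_nonneg Z_int in \<open>auto\<close>)
      finally show ?thesis .
    qed
    let ?E = "{\<omega>\<in>space M. \<exists>t. 1 / \<alpha> \<le> K t v \<omega>}"
    have "ennreal (1 / \<alpha>) * emeasure M {\<omega>\<in>space M. \<exists>t. ennreal (1 / \<alpha>) \<le> ennreal (K t v \<omega>)}
        \<le> (\<integral>\<^sup>+\<omega>. ennreal (K 0 v \<omega>) \<partial>M)"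
      using F_sub F_mono K_F[OF v] super by (intro ville_inequality[where F=F]) auto
    also have "{\<omega>\<in>space M. \<exists>t. ennreal (1 / \<alpha>) \<le> ennreal (K t v \<omega>)} = ?E"
      using K_nonneg[OF v] by (auto simp: ennreal_le_iff)
    also have "(\<integral>\<^sup>+\<omega>. ennreal (K 0 v \<omega>) \<partial>M) = (\<integral>\<^sup>+\<omega>. 1 \<partial>M)"
      using K_0[OF v] by (intro nn_integral_cong) simp
    also have "\<dots> = 1" by (simp add: emeasure_space_1)
    also have "ennreal (1 / \<alpha>) * emeasure M ?E = ennreal (1 / \<alpha> * prob ?E)"
      using \<alpha> by (subst ennreal_mult) (auto simp: emeasure_eq_measure)
    finally have "1 / \<alpha> * prob ?E \<le> 1" by (simp add: ennreal_le_1)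
    then show ?thesis using \<alpha> by (simp add: field_simps)
  qed

  \<comment> \<open>From a risk violation to a crossing\<close>
  let ?good = "{\<omega> \<in> space M. \<forall>t\<ge>1. risk M (L t) (U t) (\<rho> t) (uhat t \<omega>) \<le> \<epsilon>}"
  have uhat_cases: "\<exists>i\<in>{1..N}. uhat t \<omega> = u i \<and> (u i = 0 \<or> (\<forall>j\<in>{1..i}. K t (u j) \<omega> \<ge> 1 / \<alpha>))"
    if "t \<ge> 1" "\<omega> \<in> space M" for t \<omega>
  proof -
    have grid_ne: "{1..N} \<noteq> {}" using N by simp
    have "uhat t \<omega> \<in> (\<lambda>i. if \<forall>j\<in>{1..i}. K t (u j) \<omega> \<ge> 1 / \<alpha> then u i else 0) ` {1..N}"
      unfolding uhat_eq[OF that] using grid_ne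
      by (intro Max_in finite_imageI finite_atLeastAtMost) (simp only: image_is_empty not_False_eq_True)
    then obtain i where i: "i \<in> {1..N}"
      "uhat t \<omega> = (if \<forall>j\<in>{1..i}. K t (u j) \<omega> \<ge> 1 / \<alpha> then u i else 0)" by blast
    show ?thesis
    proof (cases "\<forall>j\<in>{1..i}. K t (u j) \<omega> \<ge> 1 / \<alpha>")
      case True
      have "uhat t \<omega> = u i" using i(2) unfolding if_P[OF True] .
      then show ?thesis using True i(1) by blast
    next
      case False
      \<comment> \<open>The default value 0 is the grid point \<open>u 1\<close>, so the threshold
        never leaves the grid.\<close>
      have "uhat t \<omega> = u 1" using i(2) unfolding if_not_P[OF False] u_first .
      then show ?thesis using u_first N by (intro bexI[of _ 1]) auto
    qed
  qed
  \<comment> \<open>\<open>measure\<close> is 0 on non-measurable sets, so measurability of the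
    event carries content. It follows from the closed form of the risk, as the monotone function
    \<open>\<theta>\<close> is Borel.\<close>
  have good_sets: "?good \<in> events"
  proof -
    have [measurable]: "\<theta> \<in> borel_measurable borel"
      using \<theta>_mono by (intro borel_measurable_mono) (simp add: mono_def)
    note [measurable] = measurable_from_subalg[OF F_sub uhat_F]
    have "?good = {\<omega> \<in> space M. \<forall>t. t \<ge> 1 \<longrightarrow> (1 - \<rho> t) * \<theta> (uhat t \<omega>) \<le> \<epsilon>}"
      using risk by auto
    also have "\<dots> \<in> events" by measurable
    finally show ?thesis .
  qed
  show ?thesis
  proof (cases "\<exists>i\<in>{1..N}. \<epsilon> < R (u i)")
    case False
    have "?good = space M"
    proof (intro equalityI subsetI CollectI conjI allI impI)
      fix \<omega> t assume "\<omega> \<in> space M" "t \<ge> (1::nat)"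
      then obtain i where "i \<in> {1..N}" "uhat t \<omega> = u i" using uhat_cases by blast
      then show "risk M (L t) (U t) (\<rho> t) (uhat t \<omega>) \<le> \<epsilon>"
        using False risk_le[OF \<open>t \<ge> 1\<close>, of "u i"] by force
    qed auto
    then show ?thesis using \<alpha> by (simp add: prob_space)
  next
    case True
    \<comment> \<open>This index depends on \<open>R\<close> only and not on the sample point, so
      one application of \<open>crossing\<close> covers all times and all thresholds.\<close>
    define m where "m = (LEAST i. i \<in> {1..N} \<and> \<epsilon> < R (u i))"
    have "m \<in> {1..N} \<and> \<epsilon> < R (u m)"
      unfolding m_def by (rule LeastI_ex) (use True in blast)
    then have m: "m \<in> {1..N}" "\<epsilon> < R (u m)" by auto
    have m_le: "m \<le> i" if "i \<in> {1..N}" "\<epsilon> < R (u i)" for i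
      unfolding m_def using that by (intro Least_le) auto
    let ?E = "{\<omega>\<in>space M. \<exists>t. 1 / \<alpha> \<le> K t (u m) \<omega>}"
    have [measurable]: "K t (u m) \<in> borel_measurable M" for t
      using m by (intro measurable_from_subalg[OF F_sub K_F]) auto
    have "space M - ?good \<subseteq> ?E"
    proof
      fix \<omega> assume "\<omega> \<in> space M - ?good"
      then obtain t where \<omega>: "\<omega> \<in> space M" and t: "t \<ge> 1"
        and gt: "\<epsilon> < risk M (L t) (U t) (\<rho> t) (uhat t \<omega>)"
        by (auto simp: not_le)
      obtain i where i: "i \<in> {1..N}" "uhat t \<omega> = u i"
        "u i = 0 \<or> (\<forall>j\<in>{1..i}. K t (u j) \<omega> \<ge> 1 / \<alpha>)"
        using uhat_cases[OF t \<omega>] by blast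
      have Ri: "\<epsilon> < R (u i)" using gt risk_le[OF t, of "u i"] i(2) by simp
      \<comment> \<open>Since \<open>R 0 = 0 < \<epsilon>\<close>, the violating threshold is not
        the default, so all wealths up to index \<open>i\<close> have reached
        \<open>1 / \<alpha>\<close>. Minimality gives \<open>m \<le> i\<close>, hence the wealth at
        \<open>u m\<close> is among them.\<close>
      then have "u i \<noteq> 0" using \<theta>_0 \<epsilon> by (auto simp: R_def)
      then have "K t (u m) \<omega> \<ge> 1 / \<alpha>" using i(3) m_le[OF i(1) Ri] m(1) by auto
      then show "\<omega> \<in> ?E" using \<omega> by blast
    qed
    then have "prob (space M - ?good) \<le> prob ?E"
      by (intro finite_measure_mono) measurable
    also have "\<dots> \<le> \<alpha>" using m by (intro crossing) auto
    finally show ?thesis using prob_compl[OF good_sets] by simp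
  qed
qed

end
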